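(* Let $\mathbf{x}$ and $\mathbf{x}'$ be two quadrilateral lattices in $\mathbb{P}^M$ related by the fundamental transformation, such that the focal lattices $\mathbf{y}_1$, $\mathbf{y}_2$ of the congruence $L$ of the transformation do not degenerate to a single point. If $\mathbf{x}'$ is the image of $\mathbf{x}$ in the unique projective involution (of the corresponding line of the congruence) mapping $\mathbf{y}_1$ into $\mathbf{y}_{1(1)}$ and $\mathbf{y}_2$ into $\mathbf{y}_{2(2)}$, then $\mathbf{x}$ and $\mathbf{x}'$ are Koenigs lattices related by the Koenigs transformation.
   Context: Notation: for a function (or family) $g$ on $\mathbb{Z}^2$, $g_{(\pm1)}(n_1,n_2)=g(n_1\pm1,n_2)$, $g_{(\pm2)}(n_1,n_2)=g(n_1,n_2\pm1)$, $g_{(12)}(n_1,n_2)=g(n_1+1,n_2+1)$, and similarly for repeated shifts; $\Delta_i g=g_{(i)}-g$. A (two-dimensional) quadrilateral lattice in $\mathbb{P}^M=\mathbb{P}(\mathbb{R}^{M+1})$ is a map $\mathbb{Z}^2\to\mathbb{P}^M$ whose elementary quadrilaterals are planar; in homogeneous coordinates $\mathbf{x}:\mathbb{Z}^2\to\mathbb{R}^{M+1}\setminus\{0\}$ it satisfies the discrete Laplace equation $\mathbf{x}_{(12)}=A_{(1)}\mathbf{x}_{(1)}+B_{(2)}\mathbf{x}_{(2)}+C\mathbf{x}$ with functions $A,B,C$ on $\mathbb{Z}^2$. Multiplying $\mathbf{x}$ by a non-zero function (change of gauge) does not change the lattice. Its Laplace transforms are $\mathbf{x}_1=\mathbf{x}_{(2)}-A\mathbf{x}$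 and $\mathbf{x}_{-1}=\mathbf{x}_{(1)}-B\mathbf{x}$. A Koenigs lattice is a two-dimensional quadrilateral lattice such that for every point $\mathbf{x}$ of the lattice there exists a conic passing through the six points $\mathbf{x}_1,\mathbf{x}_{1(1)},\mathbf{x}_{1(11)},\mathbf{x}_{-1},\mathbf{x}_{-1(2)},\mathbf{x}_{-1(22)}$ (all of them lie in the plane of the elementary quadrilateral $\mathbf{x},\mathbf{x}_{(1)},\mathbf{x}_{(2)},\mathbf{x}_{(12)}$). A (discrete two-dimensional line) congruence is a $\mathbb{Z}^2$-family of lines $L$ in $\mathbb{P}^M$ such that any two neighbouring lines intersect; its $i$-th focal lattice is $\mathbf{y}_i=L\cap L_{(-i)}$, $i=1,2$, so that $\mathbf{y}_{i(i)}=L_{(i)}\cap L$ also lies on $L$. A lattice and a congruence are conjugate if $\mathbf{x}(n_1,n_2)\in L(n_1,n_2)$ for all $(n_1,n_2)\in\mathbb{Z}^2$. Two quadrilateral lattices are related by the fundamental transformation if there exists a congruence (called the congruence of the transformation) conjugate to both. The Koenigs transformation: let $\mathbf{x}$ be a Koenigs lattice in the canonical gauge in which $\mathbf{x}_{(12)}+\mathbf{x}=F_{(1)}\mathbf{x}_{(1)}+F_{(2)}\mathbf{x}_{(2)}$ for a function $F$ on $\mathbb{Z}^2$, and let $\theta$ be a scalar solution of $\theta_{(12)}+\theta=F(\theta_{(1)}+\theta_{(2)})$. With $\phi=\theta_{(1)}+\theta_{(2)}$ and $\phi'=1/\theta_{(1)}+1/\theta_{(2)}$, the Koenigs transform $\mathbf{x}'$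 of $\mathbf{x}$ is a solution of $$\Delta_1(\mathbf{x}'/\phi')=(\theta\theta_{(2)})_{(1)}\Delta_1(\mathbf{x}/\phi),\qquad \Delta_2(\mathbf{x}'/\phi')=-(\theta\theta_{(1)})_{(2)}\Delta_2(\mathbf{x}/\phi).$$ A projective involution on a line is uniquely determined by giving two pairs of homologous points.
   Formalization: Adds general position, without which the claim fails: corresponding points of x and x' are distinct, x is never a focal point of its line of L, and the lines L, L_(1), L_(2) are never coplanar (so M ≥ 3). *)

theory Defs
  imports "HOL-Analysis.Analysis"
begin

text \<open>
  A projective subspace is represented by the linear subspace of the vector space over it:
  points are 1-dimensional, lines 2-dimensional, planes 3-dimensional linear subspaces. A lattice
  is given by homogeneous coordinates \<open>x i j \<noteq> 0\<close>; its points are \<open>span {x i j}\<close>.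
\<close>

definition laplace_eq ::
  "(int \<Rightarrow> int \<Rightarrow> real) \<Rightarrow> (int \<Rightarrow> int \<Rightarrow> real) \<Rightarrow> (int \<Rightarrow> int \<Rightarrow> real) \<Rightarrow>
   (int \<Rightarrow> int \<Rightarrow> 'a::real_vector) \<Rightarrow> bool" where
  "laplace_eq A B C x \<longleftrightarrow>
     (\<forall>i j. x (i + 1) (j + 1) =
        A (i + 1) j *\<^sub>R x (i + 1) j + B i (j + 1) *\<^sub>R x i (j + 1) + C i j *\<^sub>R x i j)"

text \<open>
  The dimension condition says that each elementary quadrilateral spans a genuine plane, with
  \<open>x i j\<close>, \<open>x (i + 1) j\<close>, \<open>x i (j + 1)\<close> not collinear. It makes the coefficients of the Laplace
  equation unique.
\<close>

definition quadrilateral_lattice :: "(int \<Rightarrow> int \<Rightarrow> 'a::euclidean_space) \<Rightarrow> bool" where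
  "quadrilateral_lattice x \<longleftrightarrow>
     (\<forall>i j. x i j \<noteq> 0) \<and>
     (\<forall>i j. dim {x i j, x (i + 1) j, x i (j + 1)} = 3) \<and>
     (\<exists>A B C. laplace_eq A B C x)"

definition laplace_transform_pos ::
  "(int \<Rightarrow> int \<Rightarrow> real) \<Rightarrow> (int \<Rightarrow> int \<Rightarrow> 'a::real_vector) \<Rightarrow> int \<Rightarrow> int \<Rightarrow> 'a" where
  "laplace_transform_pos A x i j = x i (j + 1) - A i j *\<^sub>R x i j"

definition laplace_transform_neg ::
  "(int \<Rightarrow> int \<Rightarrow> real) \<Rightarrow> (int \<Rightarrow> int \<Rightarrow> 'a::real_vector) \<Rightarrow> int \<Rightarrow> int \<Rightarrow> 'a" where
  "laplace_transform_neg B x i j = x (i + 1) j - B i j *\<^sub>R x i j"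

text \<open>
  A (possibly degenerate) conic of the plane \<open>E\<close> is the zero locus of a quadratic form that is not
  identically zero on \<open>E\<close>. Every quadratic form on the subspace \<open>E\<close> extends to the whole space, so
  the form is taken to be globally defined; only its restriction to \<open>E\<close> matters.
\<close>

definition conic_through :: "'a::euclidean_space set \<Rightarrow> 'a set \<Rightarrow> bool" where
  "conic_through E P \<longleftrightarrow>
     (\<exists>b :: 'a \<Rightarrow> 'a \<Rightarrow> real. bilinear b \<and> (\<forall>u v. b u v = b v u) \<and>
        (\<exists>u\<in>E. b u u \<noteq> 0) \<and> (\<forall>p\<in>P. b p p = 0))"

definition koenigs_lattice :: "(int \<Rightarrow> int \<Rightarrow> 'a::euclidean_space) \<Rightarrow> bool" where
  "koenigs_lattice x \<longleftrightarrow>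
     quadrilateral_lattice x \<and>
     (\<exists>A B C. laplace_eq A B C x \<and>
        (\<forall>i j. conic_through (span {x i j, x (i + 1) j, x i (j + 1)})
           {laplace_transform_pos A x i j,
            laplace_transform_pos A x (i + 1) j,
            laplace_transform_pos A x (i + 2) j,
            laplace_transform_neg B x i j,
            laplace_transform_neg B x i (j + 1),
            laplace_transform_neg B x i (j + 2)}))"

text \<open>Neighbouring lines of a congruence are distinct and meet, i.e. they meet in exactly one point.\<close>

definition line_congruence :: "(int \<Rightarrow> int \<Rightarrow> 'a::euclidean_space set) \<Rightarrow> bool" where
  "line_congruence L \<longleftrightarrow>
     (\<forall>i j. subspace (L i j) \<and> dim (L i j) = 2 \<and>
        dim (L i j \<inter> L (i + 1) j) = 1 \<and> dim (L i j \<inter> L i (j + 1)) = 1)"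

definition focal1 :: "(int \<Rightarrow> int \<Rightarrow> 'a set) \<Rightarrow> int \<Rightarrow> int \<Rightarrow> 'a set" where
  "focal1 L i j = L i j \<inter> L (i - 1) j"

definition focal2 :: "(int \<Rightarrow> int \<Rightarrow> 'a set) \<Rightarrow> int \<Rightarrow> int \<Rightarrow> 'a set" where
  "focal2 L i j = L i j \<inter> L i (j - 1)"

definition conjugate_to :: "(int \<Rightarrow> int \<Rightarrow> 'a) \<Rightarrow> (int \<Rightarrow> int \<Rightarrow> 'a set) \<Rightarrow> bool" where
  "conjugate_to x L \<longleftrightarrow> (\<forall>i j. x i j \<in> L i j)"

definition fundamental_transformation ::
  "(int \<Rightarrow> int \<Rightarrow> 'a::euclidean_space) \<Rightarrow> (int \<Rightarrow> int \<Rightarrow> 'a) \<Rightarrow> (int \<Rightarrow> int \<Rightarrow> 'a set) \<Rightarrow> bool" where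
  "fundamental_transformation x x' L \<longleftrightarrow>
     quadrilateral_lattice x \<and> quadrilateral_lattice x' \<and>
     line_congruence L \<and> conjugate_to x L \<and> conjugate_to x' L"

text \<open>
  The general position tacitly assumed for a fundamental transformation: corresponding points are
  distinct; \<open>x\<close> is not one of the focal points of its line (as it would be for Laplace and Levy
  transformations); and the lines \<open>L i j\<close>, \<open>L (i + 1) j\<close>, \<open>L i (j + 1)\<close> are not coplanar, so that
  the hexahedra formed by corresponding quadrilaterals of \<open>x\<close> and \<open>x'\<close> are three-dimensional.
\<close>

definition generic_position ::
  "(int \<Rightarrow> int \<Rightarrow> 'a::euclidean_space) \<Rightarrow> (int \<Rightarrow> int \<Rightarrow> 'a) \<Rightarrow> (int \<Rightarrow> int \<Rightarrow> 'a set) \<Rightarrow> bool" where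
  "generic_position x x' L \<longleftrightarrow>
     (\<forall>i j. span {x i j} \<noteq> span {x' i j}) \<and>
     (\<forall>i j. x i j \<notin> focal1 L i j \<and> x i j \<notin> focal1 L (i + 1) j \<and>
            x i j \<notin> focal2 L i j \<and> x i j \<notin> focal2 L i (j + 1)) \<and>
     (\<forall>i j. \<not> (\<exists>E. subspace E \<and> dim E = 3 \<and> L i j \<union> L (i + 1) j \<union> L i (j + 1) \<subseteq> E))"

definition points_on :: "'a::euclidean_space set \<Rightarrow> 'a set set" where
  "points_on l = {p. subspace p \<and> dim p = 1 \<and> p \<subseteq> l}"

text \<open>
  A projective involution of the line \<open>l\<close>: a projective transformation of \<open>l\<close>, induced by a linear
  automorphism of \<open>l\<close>, which has order exactly two. It is a map on the points of \<open>l\<close>, with a fixed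
  dummy value elsewhere (so that uniqueness is uniqueness as a transformation of \<open>l\<close>).
\<close>

definition projective_involution :: "'a::euclidean_space set \<Rightarrow> ('a set \<Rightarrow> 'a set) \<Rightarrow> bool" where
  "projective_involution l \<iota> \<longleftrightarrow>
     \<iota> \<in> extensional (points_on l) \<and>
     (\<exists>J. linear J \<and> inj_on J l \<and> J ` l = l \<and> (\<forall>p\<in>points_on l. \<iota> p = J ` p)) \<and>
     (\<forall>p\<in>points_on l. \<iota> (\<iota> p) = p) \<and>
     (\<exists>p\<in>points_on l. \<iota> p \<noteq> p)"

definition focal_involution ::
  "(int \<Rightarrow> int \<Rightarrow> 'a::euclidean_space set) \<Rightarrow> int \<Rightarrow> int \<Rightarrow> ('a set \<Rightarrow> 'a set) \<Rightarrow> bool" where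
  "focal_involution L i j \<iota> \<longleftrightarrow>
     projective_involution (L i j) \<iota> \<and>
     \<iota> (focal1 L i j) = focal1 L (i + 1) j \<and>
     \<iota> (focal2 L i j) = focal2 L i (j + 1)"

definition diff1 :: "(int \<Rightarrow> int \<Rightarrow> 'a::ab_group_add) \<Rightarrow> int \<Rightarrow> int \<Rightarrow> 'a" where
  "diff1 g i j = g (i + 1) j - g i j"

definition diff2 :: "(int \<Rightarrow> int \<Rightarrow> 'a::ab_group_add) \<Rightarrow> int \<Rightarrow> int \<Rightarrow> 'a" where
  "diff2 g i j = g i (j + 1) - g i j"

definition phi :: "(int \<Rightarrow> int \<Rightarrow> real) \<Rightarrow> int \<Rightarrow> int \<Rightarrow> real" where
  "phi \<theta> i j = \<theta> (i + 1) j + \<theta> i (j + 1)"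

definition phi' :: "(int \<Rightarrow> int \<Rightarrow> real) \<Rightarrow> int \<Rightarrow> int \<Rightarrow> real" where
  "phi' \<theta> i j = 1 / \<theta> (i + 1) j + 1 / \<theta> i (j + 1)"

text \<open>
  The Koenigs transformation in the canonical gauge. The conditions that \<open>\<theta>\<close> and \<open>\<phi>\<close> do not vanish
  are those under which the formulas make sense; then \<open>\<phi>'\<close> does not vanish either.
\<close>

definition koenigs_transformation ::
  "(int \<Rightarrow> int \<Rightarrow> real) \<Rightarrow> (int \<Rightarrow> int \<Rightarrow> real) \<Rightarrow>
   (int \<Rightarrow> int \<Rightarrow> 'a::real_vector) \<Rightarrow> (int \<Rightarrow> int \<Rightarrow> 'a) \<Rightarrow> bool" where
  "koenigs_transformation F \<theta> x x' \<longleftrightarrow>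
     (\<forall>i j. x (i + 1) (j + 1) + x i j = F (i + 1) j *\<^sub>R x (i + 1) j + F i (j + 1) *\<^sub>R x i (j + 1)) \<and>
     (\<forall>i j. \<theta> (i + 1) (j + 1) + \<theta> i j = F i j * (\<theta> (i + 1) j + \<theta> i (j + 1))) \<and>
     (\<forall>i j. \<theta> i j \<noteq> 0) \<and> (\<forall>i j. phi \<theta> i j \<noteq> 0) \<and>
     (\<forall>i j. diff1 (\<lambda>i j. x' i j /\<^sub>R phi' \<theta> i j) i j =
        (\<theta> (i + 1) j * \<theta> (i + 1) (j + 1)) *\<^sub>R diff1 (\<lambda>i j. x i j /\<^sub>R phi \<theta> i j) i j) \<and>
     (\<forall>i j. diff2 (\<lambda>i j. x' i j /\<^sub>R phi' \<theta> i j) i j =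
        - ((\<theta> i (j + 1) * \<theta> (i + 1) (j + 1)) *\<^sub>R diff2 (\<lambda>i j. x i j /\<^sub>R phi \<theta> i j) i j))"

definition koenigs_related ::
  "(int \<Rightarrow> int \<Rightarrow> 'a::real_vector) \<Rightarrow> (int \<Rightarrow> int \<Rightarrow> 'a) \<Rightarrow> bool" where
  "koenigs_related x x' \<longleftrightarrow>
     (\<exists>\<rho> \<rho>' F \<theta>. (\<forall>i j. \<rho> i j \<noteq> 0) \<and> (\<forall>i j. \<rho>' i j \<noteq> 0) \<and>
        koenigs_transformation F \<theta> (\<lambda>i j. \<rho> i j *\<^sub>R x i j) (\<lambda>i j. \<rho>' i j *\<^sub>R x' i j))"

end

theory Submission
  imports Defs
begin

text \<open>
  Neither point lies on a focal lattice, so the focal points are \<open>x' + q x = r x'\<^sub>1 + s x\<^sub>1\<close> and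
  \<open>x' + Q x = R x'\<^sub>2 + S x\<^sub>2\<close>. Since neighbouring lines are not coplanar, comparing the two
  expressions for \<open>x'\<^sub>1\<^sub>2\<close> modulo the plane of \<open>x\<close> shows that \<open>r\<close>, \<open>R\<close> can be removed by a gauge;
  dually for \<open>s / q\<close>, \<open>S / Q\<close>. In the new gauge \<open>\<Delta>\<^sub>1 y' = a \<Delta>\<^sub>1 y\<close> and \<open>\<Delta>\<^sub>2 y' = c \<Delta>\<^sub>2 y\<close>. The
  involution exchanging \<open>y\<close> and \<open>y'\<close> has the form \<open>t \<mapsto> k / t\<close> in the parameter of the points
  \<open>y' + t y\<close>, hence \<open>a\<^sub>(\<^sub>-\<^sub>1\<^sub>) a = c\<^sub>(\<^sub>-\<^sub>2\<^sub>) c\<close>. This is exactly the integrability condition for a function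
  \<open>\<theta>\<close> with \<open>\<theta> \<theta>\<^sub>2 = a\<^sub>(\<^sub>-\<^sub>1\<^sub>)\<close> and \<open>\<theta> \<theta>\<^sub>1 = - c\<^sub>(\<^sub>-\<^sub>2\<^sub>)\<close>. Uniqueness of the involution keeps the pairs
  \<open>{y\<^sub>1, y\<^sub>1\<^sub>(\<^sub>1\<^sub>)}\<close> and \<open>{y\<^sub>2, y\<^sub>2\<^sub>(\<^sub>2\<^sub>)}\<close> distinct, which makes \<open>\<phi> = \<theta>\<^sub>1 + \<theta>\<^sub>2\<close> and \<open>\<theta>\<^sub>1\<^sub>2 + \<theta>\<close> nonzero.
  Then \<open>\<phi> y\<close> is in the canonical gauge with \<open>F = (\<theta>\<^sub>1\<^sub>2 + \<theta>) / \<phi>\<close>, and so is \<open>y'\<close> after replacing \<open>\<theta>\<close>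
  by \<open>1 / \<theta>\<close>; in the canonical gauge the conic is explicit.
\<close>

section \<open>Integrable recurrences on the integer plane\<close>

text \<open>Bijectivity of the steps on \<open>S\<close> lets the recurrence also run towards
  negative indices, where each step is inverted.\<close>

lemma recurrence_int:
  fixes h :: "int \<Rightarrow> 'a \<Rightarrow> 'a"
  assumes bij: "\<And>i. bij_betw (h i) S S" and s: "s \<in> S"
  shows "\<exists>r. r 0 = s \<and> (\<forall>i. r i \<in> S \<and> r (i + 1) = h i (r i))"
proof -
  define up where "up = rec_nat s (\<lambda>n. h (int n))"
  define down where "down = rec_nat s (\<lambda>n. inv_into S (h (- int n - 1)))"
  define r where "r i = (if i \<ge> 0 then up (nat i) else down (nat (- i)))" for i
  have up: "up 0 = s" "up (Suc n) = h (int n) (up n)" for n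
    by (simp_all add: up_def)
  have down: "down 0 = s" "down (Suc n) = inv_into S (h (- int n - 1)) (down n)" for n
    by (simp_all add: down_def)
  have upS: "up n \<in> S" for n
    by (induction n) (use s in \<open>auto simp: up bij_betw_apply[OF bij]\<close>)
  have downS: "down n \<in> S" for n
    by (induction n) (use s in \<open>auto simp: down bij_betw_apply[OF bij_betw_inv_into[OF bij]]\<close>)
  have "r (i + 1) = h i (r i)" for i
  proof (cases "i \<ge> 0")
    case True
    then show ?thesis
      using up(2)[of "nat i"] by (simp add: r_def nat_add_distrib)
  next
    case False
    define n where "n = nat (- i - 1)"
    have i: "i = - int n - 1"
      using False by (simp add: n_def)
    \<comment> \<open>For \<open>n = 0\<close> the index \<open>i + 1\<close> is 0 and already
      belongs to \<open>up\<close>; both branches start at \<open>s\<close>, so they join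
      there.\<close>
    have "r (i + 1) = down n"
      by (cases n) (auto simp: i r_def up down nat_add_distrib)
    moreover have "r i = down (Suc n)"
      using False by (simp add: i r_def nat_add_distrib Suc_nat_eq_nat_zadd1)
    ultimately show ?thesis
      using bij_betw_inv_into_right[OF bij downS] by (simp add: down i)
  qed
  moreover have "r 0 = s" "r i \<in> S" for i
    using upS downS by (simp_all add: r_def up)
  ultimately show ?thesis by blast
qed

text \<open>Solve along the axis \<open>j = 0\<close>, then along every column; commutation around
  elementary squares carries the first recurrence from the axis to all \<open>j\<close>.\<close>

lemma recurrence_int2:
  fixes f g :: "int \<Rightarrow> int \<Rightarrow> 'a \<Rightarrow> 'a"
  assumes f: "\<And>i j. bij_betw (f i j) S S" and g: "\<And>i j. bij_betw (g i j) S S"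
    and comm: "\<And>i j t. t \<in> S \<Longrightarrow> g (i + 1) j (f i j t) = f i (j + 1) (g i j t)"
    and "S \<noteq> {}"
  obtains r where "\<And>i j. r i j \<in> S" "\<And>i j. r (i + 1) j = f i j (r i j)"
    "\<And>i j. r i (j + 1) = g i j (r i j)"
proof -
  obtain s where "s \<in> S"
    using \<open>S \<noteq> {}\<close> by blast
  then obtain q where q: "\<And>i. q i \<in> S" "\<And>i. q (i + 1) = f i 0 (q i)"
    using recurrence_int[of "\<lambda>i. f i 0" S s, OF f] by blast
  have "\<forall>i. \<exists>r. r 0 = q i \<and> (\<forall>j. r j \<in> S \<and> r (j + 1) = g i j (r j))"
    using recurrence_int[of "g _", OF g q(1)] by blast
  then obtain r where r0: "\<And>i. r i 0 = q i" and rS: "\<And>i j. r i j \<in> S"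
      and r2: "\<And>i j. r i (j + 1) = g i j (r i j)"
    by metis
  have "r (i + 1) j = f i j (r i j)" for i j
  proof (induction j rule: int_induct[where k = 0])
    case base
    then show ?case by (simp add: r0 q)
  next
    case (step1 j)
    then show ?case by (simp add: r2 comm rS)
  next
    case (step2 j)
    let ?k = "j - 1"
    \<comment> \<open>Going down, a step is cancelled: both candidates for
      \<open>r (i + 1) ?k\<close> have the same image under \<open>g (i + 1) ?k\<close>, which is
      injective on \<open>S\<close>.\<close>
    have "g (i + 1) ?k (r (i + 1) ?k) = g (i + 1) ?k (f i ?k (r i ?k))"
      using step2 r2[of "i + 1" ?k] r2[of i ?k] comm[OF rS, of i ?k i ?k] by simp
    then show ?case
      using g rS f by (meson bij_betw_apply bij_betw_imp_inj_on inj_onD)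
  qed
  then show thesis
    using that rS r2 by blast
qed

text \<open>The last hypothesis makes multiplication by \<open>P\<close> and by \<open>Q\<close>
  commute around each square. This supplies the gauge factors.\<close>

lemma multiplicative_potential:
  fixes P Q :: "int \<Rightarrow> int \<Rightarrow> real"
  assumes "\<And>i j. P i j \<noteq> 0" "\<And>i j. Q i j \<noteq> 0"
    and "\<And>i j. P i (j + 1) * Q i j = Q (i + 1) j * P i j"
  obtains r where "\<And>i j. r i j \<noteq> 0" "\<And>i j. r (i + 1) j = P i j * r i j"
    "\<And>i j. r i (j + 1) = Q i j * r i j"
proof -
  have bij: "bij_betw (\<lambda>t. c * t) (- {0}) (- {0})" if "c \<noteq> 0" for c :: real
    by (rule bij_betw_byWitness[where f' = "\<lambda>t. t / c"]) (use that in auto)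
  note pot = that
  show thesis
  proof (rule recurrence_int2[of "\<lambda>i j t. P i j * t" "- {0}" "\<lambda>i j t. Q i j * t"])
    show "Q (i + 1) j * (P i j * t) = P i (j + 1) * (Q i j * t)" for i j t
      using assms(3)[of i j] by (simp add: mult.assoc[symmetric])
    show "- {0::real} \<noteq> {}"
      using zero_neq_one by blast
    show thesis if "\<And>i j. r i j \<in> - {0}" "\<And>i j. r (i + 1) j = P i j * r i j"
        "\<And>i j. r i (j + 1) = Q i j * r i j" for r
      using that by (intro pot[of r]) auto
  qed (use assms bij in auto)
qed

text \<open>The steps are \<open>t \<mapsto> Q / t\<close> and \<open>t \<mapsto> P / t\<close>; the
  two ways around a square give \<open>P_(1) t / Q\<close> and \<open>Q_(2) t / P\<close>. This
  supplies \<open>\<theta>\<close>.\<close>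

lemma reciprocal_potential:
  fixes P Q :: "int \<Rightarrow> int \<Rightarrow> real"
  assumes "\<And>i j. P i j \<noteq> 0" "\<And>i j. Q i j \<noteq> 0"
    and "\<And>i j. P i j * P (i + 1) j = Q i j * Q i (j + 1)"
  obtains r where "\<And>i j. r i j \<noteq> 0" "\<And>i j. r i j * r (i + 1) j = Q i j"
    "\<And>i j. r i j * r i (j + 1) = P i j"
proof -
  have bij: "bij_betw (\<lambda>t. c / t) (- {0}) (- {0})" if "c \<noteq> 0" for c :: real
    by (rule bij_betw_byWitness[where f' = "\<lambda>t. c / t"]) (use that in auto)
  note pot = that
  show thesis
  proof (rule recurrence_int2[of "\<lambda>i j t. Q i j / t" "- {0}" "\<lambda>i j t. P i j / t"])
    show "P (i + 1) j / (Q i j / t) = Q i (j + 1) / (P i j / t)" for i j t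
      using assms(1,2)[of i j] assms(3)[of i j] by (simp add: field_simps)
    show "- {0::real} \<noteq> {}"
      using zero_neq_one by blast
    show thesis if "\<And>i j. r i j \<in> - {0}" "\<And>i j. r (i + 1) j = Q i j / r i j"
        "\<And>i j. r i (j + 1) = P i j / r i j" for r
      using that by (intro pot[of r]) auto
  qed (use assms bij in auto)
qed

section \<open>Points and involutions of a line\<close>

lemma line_spanned_by_points:
  fixes l :: "'a::euclidean_space set"
  assumes "subspace l" "dim l = 2" "e \<in> l" "e' \<in> l" "e \<noteq> 0" "e' \<noteq> 0" "span {e} \<noteq> span {e'}"
  shows "e \<noteq> e'" "independent {e, e'}" "l = span {e, e'}"
proof -
  have "e \<notin> span {e'}"
  proof
    assume "e \<in> span {e'}"
    then have "span {e} = span {e'}"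
      using assms by (intro subspace_dim_equal) (auto simp: span_minimal dim_insert)
    with assms(7) show False by simp
  qed
  then show ne: "e \<noteq> e'" and ind: "independent {e, e'}"
    using assms(6) span_base[of e' "{e'}"] by (auto simp: independent_insert)
  have "dim (span {e, e'}) = 2"
    using dim_eq_card_independent[OF ind] ne by (simp add: dim_span)
  then show "l = span {e, e'}"
    using assms by (intro subspace_dim_equal[symmetric]) (auto simp: span_minimal)
qed

lemma independent_pair_eq_0:
  fixes e e' :: "'a::real_vector"
  assumes "independent {e, e'}" "e \<noteq> e'" "s *\<^sub>R e + t *\<^sub>R e' = 0"
  shows "s = 0 \<and> t = 0"
proof -
  have "e \<notin> span {e'}" "e' \<noteq> 0"
    using assms(1,2) by (auto simp: independent_insert)
  moreover have "e = (- t / s) *\<^sub>R e'" if "s \<noteq> 0"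
  proof -
    have "s *\<^sub>R (e + (t / s) *\<^sub>R e') = 0"
      using assms(3) that by (simp add: scaleR_add_right)
    then show ?thesis
      using that by (simp add: eq_neg_iff_add_eq_0)
  qed
  ultimately have "s = 0"
    using span_scale[OF span_base] by blast
  with assms(3) \<open>e' \<noteq> 0\<close> show ?thesis by simp
qed

lemma in_span_pair:
  assumes "w \<in> span {e, e' :: 'a::real_vector}"
  obtains s t where "w = s *\<^sub>R e + t *\<^sub>R e'"
proof -
  obtain s t where "w - s *\<^sub>R e - t *\<^sub>R e' = 0"
    using assms by (auto simp: span_breakdown_eq)
  then show thesis
    using that[of s t] by (simp add: algebra_simps)
qed

lemma point_eq_span:
  assumes "p \<in> points_on l" "w \<in> p" "w \<noteq> (0 :: 'a::euclidean_space)"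
  shows "p = span {w}"
  using assms unfolding points_on_def
  by (intro subspace_dim_equal[symmetric]) (auto simp: span_minimal dim_insert)

lemma span_in_points_on:
  assumes "subspace l" "w \<in> l" "w \<noteq> (0 :: 'a::euclidean_space)"
  shows "span {w} \<in> points_on l"
  using assms by (auto simp: points_on_def span_minimal dim_insert)

lemma points_onE:
  assumes "p \<in> points_on (l :: 'a::euclidean_space set)"
  obtains w where "w \<in> p" "w \<noteq> 0" "p = span {w}"
proof -
  have "\<not> p \<subseteq> {0}"
    using assms unfolding points_on_def by (metis (mono_tags) dim_eq_0 mem_Collect_eq zero_neq_one)
  then show thesis
    using that point_eq_span[OF assms] by blast
qed

text \<open>The common point differs from the four given points, so its coordinates on each line are
  nonzero; scaling makes that of \<open>e'\<close> equal to 1.\<close>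

lemma line_intersection_relation:
  fixes l m :: "'a::euclidean_space set"
  assumes l: "subspace l" "dim l = 2" "e \<in> l" "e' \<in> l" "e \<noteq> 0" "e' \<noteq> 0" "span {e} \<noteq> span {e'}"
    and m: "subspace m" "dim m = 2" "f \<in> m" "f' \<in> m" "f \<noteq> 0" "f' \<noteq> 0" "span {f} \<noteq> span {f'}"
    and lm: "l \<inter> m \<in> points_on l"
    and notin: "e \<notin> l \<inter> m" "e' \<notin> l \<inter> m" "f \<notin> l \<inter> m" "f' \<notin> l \<inter> m"
  shows "\<exists>q r s. q \<noteq> 0 \<and> r \<noteq> 0 \<and> s \<noteq> 0 \<and> e' + q *\<^sub>R e = r *\<^sub>R f' + s *\<^sub>R f"
proof -
  obtain w where w: "w \<in> l \<inter> m" "w \<noteq> 0"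
    using points_onE[OF lm] by blast
  have sub: "subspace (l \<inter> m)"
    using l m by (simp add: subspace_inter)
  have nz: "s \<noteq> 0 \<and> t \<noteq> 0" if "w = s *\<^sub>R u + t *\<^sub>R v" "u \<notin> l \<inter> m" "v \<notin> l \<inter> m" for s t u v
  proof -
    have "c = 0" if "c *\<^sub>R z \<in> l \<inter> m" "z \<notin> l \<inter> m" for c z
      using subspace_scale[OF sub that(1), of "1 / c"] that(2) by (cases "c = 0") auto
    from this[of s u] this[of t v] show ?thesis
      using that w by (metis add.left_neutral add.right_neutral scaleR_zero_left)
  qed
  obtain s t where st: "w = s *\<^sub>R e + t *\<^sub>R e'"
    using w line_spanned_by_points(3)[OF l] in_span_pair by blast
  obtain s' t' where st': "w = s' *\<^sub>R f + t' *\<^sub>R f'"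
    using w line_spanned_by_points(3)[OF m] in_span_pair by blast
  have nz1: "s \<noteq> 0 \<and> t \<noteq> 0" and nz2: "s' \<noteq> 0 \<and> t' \<noteq> 0"
    using nz[OF st] nz[OF st'] notin by auto
  have "w /\<^sub>R t = e' + (s / t) *\<^sub>R e"
    unfolding st using nz1 by (simp add: scaleR_add_right divide_inverse mult.commute)
  moreover have "w /\<^sub>R t = (t' / t) *\<^sub>R f' + (s' / t) *\<^sub>R f"
    unfolding st' by (simp add: scaleR_add_right divide_inverse mult.commute)
  ultimately show ?thesis
    using nz1 nz2 by (intro exI[of _ "s / t"] exI[of _ "t' / t"] exI[of _ "s' / t"]) simp
qed

lemma projective_involutionE:
  assumes "projective_involution l \<iota>"
  obtains J where "linear J" "inj_on J l" "J ` l = l" "\<forall>p\<in>points_on l. \<iota> p = J ` p"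
    "\<forall>p\<in>points_on l. \<iota> (\<iota> p) = p"
  using assms unfolding projective_involution_def by (elim exE conjE) (rule that)

lemma projective_involution_involutive:
  assumes "projective_involution l \<iota>" "p \<in> points_on l"
  shows "\<iota> (\<iota> p) = p"
  using assms by (simp add: projective_involution_def)

lemma projective_involution_point:
  assumes "projective_involution l \<iota>" "subspace l" "p \<in> points_on l"
  shows "\<iota> p \<in> points_on l"
proof -
  obtain J where J: "linear J" "inj_on J l" "J ` l = l" "\<forall>p\<in>points_on l. \<iota> p = J ` p"
    "\<forall>p\<in>points_on l. \<iota> (\<iota> p) = p"
    by (rule projective_involutionE[OF assms(1)], rule that)
  have p: "subspace p" "dim p = 1" "p \<subseteq> l"
    using assms(3) by (auto simp: points_on_def)
  have "dim (J ` p) = dim p"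
    using J p by (intro dim_image_eq) (auto simp: span_eq_iff[THEN iffD2] inj_on_subset)
  then show ?thesis
    using J p assms(3) image_mono[OF p(3), of J] by (simp add: points_on_def linear_subspace_image)
qed

text \<open>The linear map exchanges the base points: \<open>J e = \<epsilon> e'\<close>,
  \<open>J e' = \<sigma> e\<close>. Hence \<open>e' + s e\<close> goes to
  \<open>\<sigma> e + s \<epsilon> e'\<close>, and \<open>k = \<sigma> / \<epsilon>\<close>.\<close>

lemma involution_parameter:
  fixes l :: "'a::euclidean_space set"
  assumes l: "subspace l" "dim l = 2" "e \<in> l" "e' \<in> l" "e \<noteq> 0" "e' \<noteq> 0" "span {e} \<noteq> span {e'}"
    and \<iota>: "projective_involution l \<iota>" "\<iota> (span {e}) = span {e'}"
  obtains k where "\<And>p s t. p \<in> points_on l \<Longrightarrow> e' + s *\<^sub>R e \<in> p \<Longrightarrow> e' + t *\<^sub>R e \<in> \<iota> p \<Longrightarrow> s * t = k"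
proof -
  note [simp] = linear_add linear_scale
  obtain J where J: "linear J" "inj_on J l" "J ` l = l" "\<forall>p\<in>points_on l. \<iota> p = J ` p"
    "\<forall>p\<in>points_on l. \<iota> (\<iota> p) = p"
    by (rule projective_involutionE[OF \<iota>(1)], rule that)
  have e: "span {e} \<in> points_on l" "span {e'} \<in> points_on l"
    using l by (simp_all add: span_in_points_on)
  have \<iota>': "\<iota> (span {e'}) = span {e}"
    using J(5)[rule_format, OF e(1)] \<iota>(2) by simp
  have "J e \<in> span {e'}" "J e' \<in> span {e}"
    using J(4)[rule_format, OF e(1)] J(4)[rule_format, OF e(2)] \<iota>(2) \<iota>' span_base[of _ "{_}"] by (metis imageI singletonI)+
  then obtain \<epsilon> \<sigma> where J_e: "J e = \<epsilon> *\<^sub>R e'" "J e' = \<sigma> *\<^sub>R e"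
    by (auto simp: span_singleton)
  have "J e \<noteq> 0"
    using J(1,2) l(1,3,5) by (metis inj_onD linear_0 subspace_0)
  then have "\<epsilon> \<noteq> 0"
    using J_e by auto
  note ind = line_spanned_by_points[OF l]
  show thesis
  proof (rule that)
    fix p s t
    assume p: "p \<in> points_on l" and s: "e' + s *\<^sub>R e \<in> p" and t: "e' + t *\<^sub>R e \<in> \<iota> p"
    have "e' + t *\<^sub>R e \<noteq> 0"
      using independent_pair_eq_0[OF ind(2,1), of t 1] by (auto simp: add.commute)
    then have "\<iota> p = span {e' + t *\<^sub>R e}"
      using point_eq_span[OF projective_involution_point[OF \<iota>(1) l(1) p] t] by simp
    moreover have "J (e' + s *\<^sub>R e) \<in> \<iota> p"
      using J(4)[rule_format, OF p] s by blast
    ultimately obtain c where "\<sigma> *\<^sub>R e + (s * \<epsilon>) *\<^sub>R e' = c *\<^sub>R (e' + t *\<^sub>R e)"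
      using J(1) by (auto simp: J_e span_singleton)
    then have "(\<sigma> - c * t) *\<^sub>R e + (s * \<epsilon> - c) *\<^sub>R e' = 0"
      by (simp add: algebra_simps)
    then have "\<sigma> - c * t = 0 \<and> s * \<epsilon> - c = 0"
      by (rule independent_pair_eq_0[OF ind(2,1)])
    then show "s * t = \<sigma> / \<epsilon>"
      using \<open>\<epsilon> \<noteq> 0\<close> by (auto simp: field_simps)
  qed
qed

text \<open>By Cayley-Hamilton a traceless 2 by 2 matrix squares to a scalar, minus its determinant.
  A nonzero scalar acts trivially on points, so the induced map is its own inverse.\<close>

lemma involution_of_traceless:
  fixes e f :: "'a::euclidean_space"
  assumes ef: "independent {e, f}" "e \<noteq> f" and det: "\<alpha>\<^sup>2 + \<beta> * \<gamma> \<noteq> 0"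
  obtains \<iota> where "projective_involution (span {e, f}) \<iota>"
    "\<And>s t. s *\<^sub>R e + t *\<^sub>R f \<noteq> 0 \<Longrightarrow> \<iota> (span {s *\<^sub>R e + t *\<^sub>R f}) =
      span {(s * \<alpha> + t * \<gamma>) *\<^sub>R e + (s * \<beta> - t * \<alpha>) *\<^sub>R f}"
proof -
  let ?l = "span {e, f}" and ?\<delta> = "\<alpha>\<^sup>2 + \<beta> * \<gamma>"
  obtain J where J: "linear J" "J e = \<alpha> *\<^sub>R e + \<beta> *\<^sub>R f" "J f = \<gamma> *\<^sub>R e - \<alpha> *\<^sub>R f"
    using linear_independent_extend[OF ef(1), of "\<lambda>v. if v = e then \<alpha> *\<^sub>R e + \<beta> *\<^sub>R f else \<gamma> *\<^sub>R e - \<alpha> *\<^sub>R f"]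
      ef(2) by auto
  have J_comb: "J (s *\<^sub>R e + t *\<^sub>R f) = (s * \<alpha> + t * \<gamma>) *\<^sub>R e + (s * \<beta> - t * \<alpha>) *\<^sub>R f" for s t
    by (simp add: linear_add[OF J(1)] linear_scale[OF J(1)] J algebra_simps)
  have Jl: "J w \<in> ?l" if "w \<in> ?l" for w
    using that by (elim in_span_pair) (simp add: J_comb span_add span_scale span_base)
  have JJ: "J (J w) = ?\<delta> *\<^sub>R w" if "w \<in> ?l" for w
    using that
  proof (rule in_span_pair)
    fix s t assume w: "w = s *\<^sub>R e + t *\<^sub>R f"
    show ?thesis
      unfolding w J_comb by (simp add: algebra_simps power2_eq_square)
  qed
  have inj: "inj_on J ?l"
    by (rule inj_onI) (metis JJ det scaleR_cancel_left)
  have J_image: "J ` (J ` p) = p" if "subspace p" "p \<subseteq> ?l" for p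
  proof -
    have "J ` (J ` p) = (\<lambda>w. ?\<delta> *\<^sub>R w) ` p"
      using that JJ by (auto simp: image_image intro!: image_cong)
    also have "\<dots> = p"
    proof
      show "p \<subseteq> (\<lambda>w. ?\<delta> *\<^sub>R w) ` p"
      proof
        fix w assume "w \<in> p"
        then have "w = ?\<delta> *\<^sub>R ((1 / ?\<delta>) *\<^sub>R w)" "(1 / ?\<delta>) *\<^sub>R w \<in> p"
          using det that by (auto simp: subspace_scale)
        then show "w \<in> (\<lambda>w. ?\<delta> *\<^sub>R w) ` p" by blast
      qed
    qed (use that in \<open>auto simp: subspace_scale\<close>)
    finally show ?thesis .
  qed
  define \<iota> where "\<iota> = (\<lambda>p\<in>points_on ?l. J ` p)"
  have \<iota>_span: "\<iota> (span {w}) = span {J w}" if "w \<in> ?l" "w \<noteq> 0" for w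
    using span_in_points_on[OF subspace_span that] linear_span_image[OF J(1), of "{w}"]
    by (simp add: \<iota>_def)
  have ne: "e \<noteq> 0" "f \<noteq> 0" "e + f \<noteq> 0"
    using independent_pair_eq_0[OF ef, of 1 1] ef dependent_zero[of "{e, f}"] by auto
  \<comment> \<open>If every point were fixed, \<open>e\<close>, \<open>f\<close> and
    \<open>e + f\<close> would be eigenvectors and \<open>J\<close> a scalar on the line; being
    traceless it would vanish, against \<open>det\<close>.\<close>
  have not_id: "\<exists>p\<in>points_on ?l. \<iota> p \<noteq> p"
  proof (rule ccontr)
    assume id: "\<not> ?thesis"
    have fixed: "\<exists>c. J w = c *\<^sub>R w" if "w \<in> ?l" "w \<noteq> 0" for w
      using id \<iota>_span[OF that] span_in_points_on[OF subspace_span that] span_base[of "J w" "{J w}"]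
      by (auto simp: span_singleton)
    have "e \<in> ?l" "f \<in> ?l" "e + f \<in> ?l"
      by (auto intro: span_add span_base)
    with fixed ne obtain a b c where abc: "J e = a *\<^sub>R e" "J f = b *\<^sub>R f" "J (e + f) = c *\<^sub>R (e + f)"
      by metis
    have "(\<alpha> - a) *\<^sub>R e + \<beta> *\<^sub>R f = 0" "\<gamma> *\<^sub>R e + (- \<alpha> - b) *\<^sub>R f = 0"
      using abc J(2,3) by (simp_all add: algebra_simps)
    then have 1: "\<beta> = 0" "\<gamma> = 0"
      using independent_pair_eq_0[OF ef] by blast+
    have "(\<alpha> - c) *\<^sub>R e + (- \<alpha> - c) *\<^sub>R f = 0"
      using abc(3) J(2,3) 1 by (simp add: linear_add[OF J(1)] algebra_simps)
    then have "\<alpha> - c = 0 \<and> - \<alpha> - c = 0"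
      by (rule independent_pair_eq_0[OF ef])
    then show False
      using det 1 by simp
  qed
  have J_points: "J ` p \<in> points_on ?l" if "p \<in> points_on ?l" for p
  proof -
    have p: "subspace p" "dim p = 1" "p \<subseteq> ?l"
      using that by (auto simp: points_on_def)
    have "dim (J ` p) = dim p"
      using J(1) inj p by (intro dim_image_eq) (auto simp: span_eq_iff[THEN iffD2] inj_on_subset)
    then show ?thesis
      using p Jl J(1) by (auto simp: points_on_def linear_subspace_image)
  qed
  show thesis
  proof (rule that)
    show "projective_involution ?l \<iota>"
      unfolding projective_involution_def
    proof (intro conjI exI[of _ J])
      show "J ` ?l = ?l"
        using J_image[of ?l] Jl by auto
      show "\<forall>p\<in>points_on ?l. \<iota> (\<iota> p) = p"
        using J_points J_image by (auto simp: \<iota>_def points_on_def)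
    qed (use J(1) inj not_id in \<open>auto simp: \<iota>_def\<close>)
    fix s t
    assume "s *\<^sub>R e + t *\<^sub>R f \<noteq> 0"
    then show "\<iota> (span {s *\<^sub>R e + t *\<^sub>R f}) =
      span {(s * \<alpha> + t * \<gamma>) *\<^sub>R e + (s * \<beta> - t * \<alpha>) *\<^sub>R f}"
      using \<iota>_span[of "s *\<^sub>R e + t *\<^sub>R f"]
      by (simp add: J_comb span_add span_scale span_base)
  qed
qed

text \<open>One prescribed pair leaves a family of involutions; two members that differ at another
  point are exhibited. This later shows that the two focal pairs of a line are distinct.\<close>

lemma involution_not_unique:
  fixes l :: "'a::euclidean_space set"
  assumes l: "subspace l" "dim l = 2" and p: "p \<in> points_on l" and q: "q \<in> points_on l"
  shows "\<not> (\<exists>!\<iota>. projective_involution l \<iota> \<and> \<iota> p = q)"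
proof -
  obtain e where e: "e \<in> p" "e \<noteq> 0" "p = span {e}"
    using p by (rule points_onE)
  have el: "e \<in> l"
    using p e by (auto simp: points_on_def)
  have "\<exists>\<iota> \<kappa> r. projective_involution l \<iota> \<and> \<iota> p = q \<and> projective_involution l \<kappa> \<and> \<kappa> p = q \<and> \<iota> r \<noteq> \<kappa> r"
  proof (cases "p = q")
    case True
    have "\<not> l \<subseteq> span {e}"
      using dim_subset[of l "span {e}"] l(2) e(2) by (auto simp: dim_insert)
    then obtain f where f: "f \<in> l" "f \<notin> span {e}"
      by blast
    then have "f \<noteq> 0" "span {e} \<noteq> span {f}"
      using span_0 span_base[of f "{f}"] by auto
    note ef = line_spanned_by_points[OF l el f(1) e(2) this]
    \<comment> \<open>Both matrices have \<open>e\<close> as an eigenvector, but send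
      \<open>f\<close> to \<open>- f\<close> and to \<open>e - f\<close> respectively.\<close>
    obtain \<iota> where \<iota>: "projective_involution l \<iota>"
      "\<And>s t. s *\<^sub>R e + t *\<^sub>R f \<noteq> 0 \<Longrightarrow> \<iota> (span {s *\<^sub>R e + t *\<^sub>R f}) = span {s *\<^sub>R e + (- t) *\<^sub>R f}"
      using involution_of_traceless[OF ef(2,1), of 1 0 0] ef(3) by auto
    obtain \<kappa> where \<kappa>: "projective_involution l \<kappa>"
      "\<And>s t. s *\<^sub>R e + t *\<^sub>R f \<noteq> 0 \<Longrightarrow> \<kappa> (span {s *\<^sub>R e + t *\<^sub>R f}) = span {(s + t) *\<^sub>R e + (- t) *\<^sub>R f}"
      using involution_of_traceless[OF ef(2,1), of 1 0 1] ef(3) by auto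
    have "span {- f} \<noteq> span {e - f}"
    proof
      assume "span {- f} = span {e - f}"
      then obtain c where "e - f = c *\<^sub>R (- f)"
        using span_base[of "e - f" "{e - f}"] by (auto simp: span_singleton)
      then have "1 *\<^sub>R e + (c - 1) *\<^sub>R f = 0"
        by (simp add: algebra_simps)
      then show False
        using independent_pair_eq_0[OF ef(2,1)] by fastforce
    qed
    then show ?thesis
      using \<iota> \<iota>(2)[of 1 0] \<iota>(2)[of 0 1] \<kappa> \<kappa>(2)[of 1 0] \<kappa>(2)[of 0 1] e \<open>f \<noteq> 0\<close> True
      by (intro exI[of _ \<iota>] exI[of _ \<kappa>] exI[of _ "span {f}"]) auto
  next
    case False
    obtain f where f: "f \<in> q" "f \<noteq> 0" "q = span {f}"
      using q by (rule points_onE)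
    have fl: "f \<in> l"
      using q f by (auto simp: points_on_def)
    have "span {e} \<noteq> span {f}"
      using False e f by simp
    note ef = line_spanned_by_points[OF l el fl e(2) f(2) this]
    \<comment> \<open>Both maps send \<open>e\<close> to \<open>f\<close>, but \<open>f\<close> goes
      to \<open>e\<close> or to \<open>- e\<close>, which separates them at
      \<open>e + f\<close>.\<close>
    obtain \<iota> where \<iota>: "projective_involution l \<iota>"
      "\<And>s t. s *\<^sub>R e + t *\<^sub>R f \<noteq> 0 \<Longrightarrow> \<iota> (span {s *\<^sub>R e + t *\<^sub>R f}) = span {t *\<^sub>R e + s *\<^sub>R f}"
      using involution_of_traceless[OF ef(2,1), of 0 1 1] ef(3) by auto
    obtain \<kappa> where \<kappa>: "projective_involution l \<kappa>"
      "\<And>s t. s *\<^sub>R e + t *\<^sub>R f \<noteq> 0 \<Longrightarrow> \<kappa> (span {s *\<^sub>R e + t *\<^sub>R f}) = span {(- t) *\<^sub>R e + s *\<^sub>R f}"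
      using involution_of_traceless[OF ef(2,1), of 0 1 "-1"] ef(3) by auto
    have ne: "e + f \<noteq> 0"
      using independent_pair_eq_0[OF ef(2,1), of 1 1] by auto
    have "span {e + f} \<noteq> span {f - e}"
    proof
      assume "span {e + f} = span {f - e}"
      then obtain c where "f - e = c *\<^sub>R (e + f)"
        using span_base[of "f - e" "{f - e}"] by (auto simp: span_singleton)
      then have "(c + 1) *\<^sub>R e + (c - 1) *\<^sub>R f = 0"
        by (simp add: algebra_simps)
      then show False
        using independent_pair_eq_0[OF ef(2,1), of "c + 1" "c - 1"] by auto
    qed
    then show ?thesis
      using \<iota> \<iota>(2)[of 1 0] \<iota>(2)[of 1 1] \<kappa> \<kappa>(2)[of 1 0] \<kappa>(2)[of 1 1] e f ne
      by (intro exI[of _ \<iota>] exI[of _ \<kappa>] exI[of _ "span {e + f}"]) auto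
  qed
  then show ?thesis
    by metis
qed

section \<open>The canonical gauge of a Koenigs lattice\<close>

lemma dim_3_independent:
  fixes u v w :: "'a::euclidean_space"
  assumes "dim {u, v, w} = 3"
  shows "independent {u, v, w}" "u \<noteq> v" "u \<noteq> w" "v \<noteq> w"
proof -
  have "card {u, v, w} \<ge> 3"
    using dim_le_card'[of "{u, v, w}"] assms by simp
  then show ne: "u \<noteq> v" "u \<noteq> w" "v \<noteq> w"
    by (auto simp: card_insert_if split: if_splits)
  then show "independent {u, v, w}"
    using card_eq_dim[of "{u, v, w}" "{u, v, w}"] assms span_superset[of "{u, v, w}"] by simp
qed

text \<open>Coordinates of the plane, extended to the whole space because
  \<open>conic_through\<close> takes a globally defined form.\<close>

lemma dual_basis_3:
  fixes u v w :: "'a::euclidean_space"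
  assumes "dim {u, v, w} = 3"
  obtains U V W :: "'a \<Rightarrow> real" where "linear U" "linear V" "linear W"
    "U u = 1" "U v = 0" "U w = 0" "V u = 0" "V v = 1" "V w = 0" "W u = 0" "W v = 0" "W w = 1"
proof -
  note ind = dim_3_independent[OF assms]
  have "\<exists>g :: 'a \<Rightarrow> real. linear g \<and> g u = a \<and> g v = b \<and> g w = c" for a b c
    using linear_independent_extend[OF ind(1), of "\<lambda>z. if z = u then a else if z = v then b else c"]
      ind(2-4) by auto
  then show thesis
    using that by metis
qed

text \<open>
  In the coordinates of the basis \<open>u, v, w\<close> the conic meets the line spanned by \<open>u\<close> and \<open>w\<close> in the
  first two points and the line spanned by \<open>u\<close> and \<open>v\<close> in the fourth and fifth; this determines it
  up to the coefficient of the product of the last two coordinates. Either of the two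
  remaining points fixes that coefficient to the same value.
\<close>

lemma conic_through_canonical:
  fixes u v w :: "'a::euclidean_space"
  assumes dim: "dim {u, v, w} = 3" and nz: "g \<noteq> 0" "h \<noteq> 0" "k \<noteq> 0"
  shows "conic_through (span {u, v, w})
    {w - f *\<^sub>R u, h *\<^sub>R w - u, k *\<^sub>R (g *\<^sub>R v + h *\<^sub>R w - u) - v,
     v - f *\<^sub>R u, g *\<^sub>R v - u, k *\<^sub>R (g *\<^sub>R v + h *\<^sub>R w - u) - w}"
proof -
  obtain U V W :: "'a \<Rightarrow> real" where lin: "linear U" "linear V" "linear W"
    and dual: "U u = 1" "U v = 0" "U w = 0" "V u = 0" "V v = 1" "V w = 0" "W u = 0" "W v = 0" "W w = 1"
    using dual_basis_3[OF dim] .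
  note [simp] = lin[THEN linear_add] lin[THEN linear_diff] lin[THEN linear_scale] dual
  \<comment> \<open>For \<open>W = 0\<close> the form factors as
    \<open>2 h (U + f V) (g U + V)\<close>, for \<open>V = 0\<close> as
    \<open>2 g (U + f W) (h U + W)\<close>; the zeros are the four points on these two
    lines.\<close>
  define b where "b p q = 2 * g * h * U p * U q + 2 * h * f * V p * V q + 2 * g * f * W p * W q
    + g * (1 + f * h) * (U p * W q + W p * U q) + h * (1 + f * g) * (U p * V q + V p * U q)
    + (1 + f / k) * (V p * W q + W p * V q)" for p q
  have "bilinear b"
    unfolding bilinear_def linear_iff by (simp add: b_def algebra_simps)
  moreover have "b p q = b q p" for p q
    by (simp add: b_def algebra_simps)
  moreover have "b u u \<noteq> 0"
    using nz by (simp add: b_def)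
  moreover have "\<forall>p\<in>{w - f *\<^sub>R u, h *\<^sub>R w - u, k *\<^sub>R (g *\<^sub>R v + h *\<^sub>R w - u) - v,
     v - f *\<^sub>R u, g *\<^sub>R v - u, k *\<^sub>R (g *\<^sub>R v + h *\<^sub>R w - u) - w}. b p p = 0"
    using nz by (simp add: b_def field_simps)
  ultimately show ?thesis
    unfolding conic_through_def using span_base[of u "{u, v, w}"] by (intro exI[of _ b]) auto
qed

text \<open>A change of gauge rescales the Laplace transforms, which does not affect the vanishing
  of a quadratic form.\<close>

lemma conic_through_scaled:
  fixes E P Q :: "'a::euclidean_space set"
  assumes "conic_through E P" "\<And>p. p \<in> Q \<Longrightarrow> \<exists>c. \<exists>q\<in>P. p = c *\<^sub>R q"
  shows "conic_through E Q"
proof -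
  obtain b :: "'a \<Rightarrow> 'a \<Rightarrow> real" where b: "bilinear b" "\<forall>u v. b u v = b v u" "\<exists>u\<in>E. b u u \<noteq> 0" "\<forall>p\<in>P. b p p = 0"
    using assms(1) unfolding conic_through_def by blast
  have "b p p = 0" if "p \<in> Q" for p
    using assms(2)[OF that] b(4) by (auto simp: bilinear_lmul[OF b(1)] bilinear_rmul[OF b(1)])
  with b show ?thesis
    unfolding conic_through_def by (intro exI[of _ b]) simp
qed

lemma span_scale_3:
  fixes u v w :: "'a::real_vector"
  assumes "a \<noteq> 0" "b \<noteq> 0" "c \<noteq> 0"
  shows "span {a *\<^sub>R u, b *\<^sub>R v, c *\<^sub>R w} = span {u, v, w}"
proof
  show "span {a *\<^sub>R u, b *\<^sub>R v, c *\<^sub>R w} \<subseteq> span {u, v, w}"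
    by (intro span_minimal) (auto intro: span_scale span_base)
  have "z \<in> span {a *\<^sub>R u, b *\<^sub>R v, c *\<^sub>R w}" if "d \<noteq> 0" "d *\<^sub>R z \<in> {a *\<^sub>R u, b *\<^sub>R v, c *\<^sub>R w}" for d z
    using span_scale[OF span_base[OF that(2)], of "1 / d"] that(1) by simp
  then show "span {u, v, w} \<subseteq> span {a *\<^sub>R u, b *\<^sub>R v, c *\<^sub>R w}"
    using assms by (intro span_minimal subspace_span) simp
qed

text \<open>Up to gauge factors the six Laplace transforms are the points of
  \<open>conic_through_canonical\<close> with \<open>f = F\<close>, \<open>g = F_(1)\<close>,
  \<open>h = F_(2)\<close>, \<open>k = F_(12)\<close>.\<close>

lemma koenigs_lattice_of_canonical_gauge:
  fixes x :: "int \<Rightarrow> int \<Rightarrow> 'a::euclidean_space"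
  assumes x: "quadrilateral_lattice x" and \<sigma>: "\<And>i j. \<sigma> i j \<noteq> 0" and F: "\<And>i j. F i j \<noteq> 0"
    and X: "\<And>i j. X i j = \<sigma> i j *\<^sub>R x i j"
    and canonical: "\<And>i j. X (i + 1) (j + 1) + X i j =
      F (i + 1) j *\<^sub>R X (i + 1) j + F i (j + 1) *\<^sub>R X i (j + 1)"
  shows "koenigs_lattice x"
proof -
  \<comment> \<open>Read off from the canonical equation divided by \<open>\<sigma>_(12)\<close>,
    with the shifts of \<open>laplace_eq\<close> undone in \<open>A\<close> and
    \<open>B\<close>.\<close>
  define A where "A i j = \<sigma> i j / \<sigma> i (j + 1) * F i j" for i j
  define B where "B i j = \<sigma> i j / \<sigma> (i + 1) j * F i j" for i j
  define C where "C i j = - \<sigma> i j / \<sigma> (i + 1) (j + 1)" for i j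
  have x_eq: "x i j = (1 / \<sigma> i j) *\<^sub>R X i j" for i j
    using \<sigma> by (simp add: X)
  have X12: "X (i + 1) (j + 1) = F (i + 1) j *\<^sub>R X (i + 1) j + F i (j + 1) *\<^sub>R X i (j + 1) - X i j" for i j
    using canonical[of i j] by (simp add: eq_diff_eq)
  have "laplace_eq A B C x"
    unfolding laplace_eq_def x_eq X12
    using \<sigma> by (simp add: A_def B_def C_def scaleR_add_right scaleR_diff_right)
  moreover have "conic_through (span {x i j, x (i + 1) j, x i (j + 1)})
     {laplace_transform_pos A x i j, laplace_transform_pos A x (i + 1) j,
      laplace_transform_pos A x (i + 2) j, laplace_transform_neg B x i j,
      laplace_transform_neg B x i (j + 1), laplace_transform_neg B x i (j + 2)}" for i j
  proof -
    have span: "span {x i j, x (i + 1) j, x i (j + 1)} = span {X i j, X (i + 1) j, X i (j + 1)}"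
      unfolding X using \<sigma> by (simp add: span_scale_3)
    have "dim {x i j, x (i + 1) j, x i (j + 1)} = 3"
      using x by (simp add: quadrilateral_lattice_def)
    then have "dim {X i j, X (i + 1) j, X i (j + 1)} = 3"
      using span by (metis dim_span)
    note conic = conic_through_canonical[OF this F[of "i + 1" j] F[of i "j + 1"] F[of "i + 1" "j + 1"], of "F i j"]
    have pos: "laplace_transform_pos A x i j = (1 / \<sigma> i (j + 1)) *\<^sub>R (X i (j + 1) - F i j *\<^sub>R X i j)" for i j
      using \<sigma> by (simp add: laplace_transform_pos_def A_def x_eq scaleR_diff_right)
    have neg: "laplace_transform_neg B x i j = (1 / \<sigma> (i + 1) j) *\<^sub>R (X (i + 1) j - F i j *\<^sub>R X i j)" for i j
      using \<sigma> by (simp add: laplace_transform_neg_def B_def x_eq scaleR_diff_right)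
    \<comment> \<open>The canonical equation turns a once shifted transform into a combination of
      two vertices of the unshifted quadrilateral.\<close>
    have *: "X (i + 1) (j + 1) - F (i + 1) j *\<^sub>R X (i + 1) j = F i (j + 1) *\<^sub>R X i (j + 1) - X i j"
      "X (i + 1) (j + 1) - F i (j + 1) *\<^sub>R X i (j + 1) = F (i + 1) j *\<^sub>R X (i + 1) j - X i j" for i j
      by (simp_all add: X12)
    \<comment> \<open>In this form the doubly shifted transforms match these relations at a
      neighbouring site.\<close>
    have 2: "i + 2 = (i + 1) + 1" for i :: int
      by simp
    show ?thesis
      unfolding span using conic
    proof (rule conic_through_scaled)
      fix p
      assume "p \<in> {laplace_transform_pos A x i j, laplace_transform_pos A x (i + 1) j,
        laplace_transform_pos A x (i + 2) j, laplace_transform_neg B x i j,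
        laplace_transform_neg B x i (j + 1), laplace_transform_neg B x i (j + 2)}"
      then show "\<exists>c. \<exists>q\<in>{X i (j + 1) - F i j *\<^sub>R X i j, F i (j + 1) *\<^sub>R X i (j + 1) - X i j,
          F (i + 1) (j + 1) *\<^sub>R (F (i + 1) j *\<^sub>R X (i + 1) j + F i (j + 1) *\<^sub>R X i (j + 1) - X i j) - X (i + 1) j,
          X (i + 1) j - F i j *\<^sub>R X i j, F (i + 1) j *\<^sub>R X (i + 1) j - X i j,
          F (i + 1) (j + 1) *\<^sub>R (F (i + 1) j *\<^sub>R X (i + 1) j + F i (j + 1) *\<^sub>R X i (j + 1) - X i j) - X i (j + 1)}.
          p = c *\<^sub>R q"
        unfolding 2 pos neg * X12[symmetric] by blast
    qed
  qed
  ultimately show ?thesis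
    using x unfolding koenigs_lattice_def by blast
qed

text \<open>Modulo the plane of the quadrilateral of \<open>x\<close>, the relations read
  \<open>x' = r x'_(1)\<close> and \<open>x' = R x'_(2)\<close>. Two paths lead to
  \<open>x'_(12)\<close>, with factors \<open>r R_(1)\<close> and \<open>R r_(2)\<close>, which must
  agree.\<close>

lemma closing_condition:
  fixes x x' :: "int \<Rightarrow> int \<Rightarrow> 'a::euclidean_space"
  assumes planar: "laplace_eq A B C x"
    and rel1: "\<And>i j. x' i j + q i j *\<^sub>R x i j = r i j *\<^sub>R x' (i + 1) j + s i j *\<^sub>R x (i + 1) j"
    and rel2: "\<And>i j. x' i j + Q i j *\<^sub>R x i j = R i j *\<^sub>R x' i (j + 1) + S i j *\<^sub>R x i (j + 1)"
    and nz: "\<And>i j. r i j \<noteq> 0" "\<And>i j. R i j \<noteq> 0"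
    and L: "\<And>i j. L i j = span {x i j, x' i j}"
    and dim: "dim {x i j, x (i + 1) j, x i (j + 1)} = 3"
    and not_coplanar: "\<not> (\<exists>E. subspace E \<and> dim E = 3 \<and> L i j \<union> L (i + 1) j \<union> L i (j + 1) \<subseteq> E)"
  shows "r i (j + 1) * R i j = R (i + 1) j * r i j"
proof (rule ccontr)
  assume ne: "\<not> ?thesis"
  let ?E = "span {x i j, x (i + 1) j, x i (j + 1)}"
  have E: "x i j \<in> ?E" "x (i + 1) j \<in> ?E" "x i (j + 1) \<in> ?E"
    by (auto intro: span_base)
  then have E12: "x (i + 1) (j + 1) \<in> ?E"
    using planar by (simp add: laplace_eq_def span_add span_scale)
  have *: "z - t *\<^sub>R z' \<in> ?E" if "z + a *\<^sub>R w = t *\<^sub>R z' + b *\<^sub>R w'" "w \<in> ?E" "w' \<in> ?E" for z z' w w' a b t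
  proof -
    have "z - t *\<^sub>R z' = b *\<^sub>R w' - a *\<^sub>R w"
      using that(1) by (simp add: algebra_simps)
    then show ?thesis
      using that(2,3) by (simp add: span_diff span_scale)
  qed
  note 1 = *[OF rel1[of i j] E(1,2)] and 2 = *[OF rel2[of i j] E(1,3)]
    and 3 = *[OF rel2[of "i + 1" j] E(2) E12] and 4 = *[OF rel1[of i "j + 1"] E(3) E12]
  \<comment> \<open>Otherwise both neighbours of \<open>x'\<close> would lie in \<open>?E\<close>
    too, and with them the three lines.\<close>
  have notin: "x' i j \<notin> ?E"
  proof
    assume *: "x' i j \<in> ?E"
    have mem: "z' \<in> ?E" if "z - t *\<^sub>R z' \<in> ?E" "z \<in> ?E" "t \<noteq> 0" for z z' t
      using span_scale[OF span_diff[OF that(2,1)], of "1 / t"] that(3) by simp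
    have "x' (i + 1) j \<in> ?E" "x' i (j + 1) \<in> ?E"
      using mem[OF 1 *] mem[OF 2 *] nz by auto
    then have "L i j \<union> L (i + 1) j \<union> L i (j + 1) \<subseteq> ?E"
      unfolding L using * E by (intro Un_least span_minimal subspace_span) simp_all
    then show False
      using not_coplanar dim by (metis dim_span subspace_span)
  qed
  let ?z = "x' (i + 1) (j + 1)"
  have a: "x' i j - (r i j * R (i + 1) j) *\<^sub>R ?z \<in> ?E"
    using span_add[OF 1 span_scale[OF 3, of "r i j"]] by (simp add: algebra_simps)
  have b: "x' i j - (R i j * r i (j + 1)) *\<^sub>R ?z \<in> ?E"
    using span_add[OF 2 span_scale[OF 4, of "R i j"]] by (simp add: algebra_simps)
  \<comment> \<open>Subtracting the two paths: different factors would put \<open>x'_(12)\<close>,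
    hence \<open>x'\<close>, into \<open>?E\<close>.\<close>
  have "(R i j * r i (j + 1) - r i j * R (i + 1) j) *\<^sub>R ?z \<in> ?E"
    using span_diff[OF a b] by (simp add: algebra_simps)
  from span_scale[OF this, of "1 / (R i j * r i (j + 1) - r i j * R (i + 1) j)"]
  have "?z \<in> ?E"
    using ne by (simp add: mult.commute)
  from span_add[OF a span_scale[OF this, of "r i j * R (i + 1) j"]] notin show False
    by simp
qed

text \<open>Evaluate the mixed difference of \<open>y'\<close> in both orders. Every term contains
  \<open>\<theta>_(12)\<close>; cancelling it leaves a four-term relation with coefficients
  \<open>\<phi>_(12)\<close>, \<open>\<phi>\<close>, \<open>(F \<phi>)_(1)\<close>,
  \<open>(F \<phi>)_(2)\<close>.\<close>

lemma canonical_of_potential: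
  fixes y y' :: "int \<Rightarrow> int \<Rightarrow> 'a::real_vector"
  assumes \<theta>: "\<And>i j. \<theta> i j \<noteq> 0" and \<phi>: "\<And>i j. phi \<theta> i j \<noteq> 0"
    and d1: "\<And>i j. diff1 y' i j = (\<theta> (i + 1) j * \<theta> (i + 1) (j + 1)) *\<^sub>R diff1 y i j"
    and d2: "\<And>i j. diff2 y' i j = - ((\<theta> i (j + 1) * \<theta> (i + 1) (j + 1)) *\<^sub>R diff2 y i j)"
  defines "F \<equiv> \<lambda>i j. (\<theta> (i + 1) (j + 1) + \<theta> i j) / phi \<theta> i j"
  defines "X \<equiv> \<lambda>i j. phi \<theta> i j *\<^sub>R y i j"
  shows "X (i + 1) (j + 1) + X i j = F (i + 1) j *\<^sub>R X (i + 1) j + F i (j + 1) *\<^sub>R X i (j + 1)"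
proof -
  let ?t = "\<theta> (i + 1) (j + 1)" and ?t1 = "\<theta> (i + 1) j" and ?t2 = "\<theta> i (j + 1)"
    and ?t112 = "\<theta> (i + 1 + 1) (j + 1)" and ?t122 = "\<theta> (i + 1) (j + 1 + 1)"
    and ?y = "y i j" and ?y1 = "y (i + 1) j" and ?y2 = "y i (j + 1)" and ?y12 = "y (i + 1) (j + 1)"
  have "diff2 y' (i + 1) j - diff2 y' i j = diff1 y' i (j + 1) - diff1 y' i j"
    by (simp add: diff1_def diff2_def)
  then have "?t *\<^sub>R (?t122 *\<^sub>R (?y12 - ?y2) + ?t112 *\<^sub>R (?y12 - ?y1) - ?t1 *\<^sub>R (?y1 - ?y) - ?t2 *\<^sub>R (?y2 - ?y)) = 0"
    unfolding d1 d2 by (simp add: diff1_def diff2_def algebra_simps)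
  then have "?t122 *\<^sub>R (?y12 - ?y2) + ?t112 *\<^sub>R (?y12 - ?y1) - ?t1 *\<^sub>R (?y1 - ?y) - ?t2 *\<^sub>R (?y2 - ?y) = 0"
    using \<theta> by simp
  then have "(?t112 + ?t122) *\<^sub>R ?y12 + (?t1 + ?t2) *\<^sub>R ?y = (?t112 + ?t1) *\<^sub>R ?y1 + (?t122 + ?t2) *\<^sub>R ?y2"
    by (simp add: algebra_simps)
  moreover have "F (i + 1) j *\<^sub>R X (i + 1) j = (?t112 + ?t1) *\<^sub>R ?y1" "F i (j + 1) *\<^sub>R X i (j + 1) = (?t122 + ?t2) *\<^sub>R ?y2"
    using \<phi>[of "i + 1" j] \<phi>[of i "j + 1"] by (simp_all add: F_def X_def)
  moreover have "X (i + 1) (j + 1) + X i j = (?t112 + ?t122) *\<^sub>R ?y12 + (?t1 + ?t2) *\<^sub>R ?y"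
    by (simp add: X_def phi_def)
  ultimately show ?thesis
    by metis
qed

theorem proposition4p5:
  fixes x x' :: "int \<Rightarrow> int \<Rightarrow> real ^ 'm"
    and L :: "int \<Rightarrow> int \<Rightarrow> (real ^ 'm) set"
  assumes "fundamental_transformation x x' L"
    and "generic_position x x' L"
    and "\<not> (\<exists>p. \<forall>i j. focal1 L i j = p)"
    and "\<not> (\<exists>p. \<forall>i j. focal2 L i j = p)"
    and "\<And>i j. \<exists>!\<iota>. focal_involution L i j \<iota>"
    and "\<And>i j. (THE \<iota>. focal_involution L i j \<iota>) (span {x i j}) = span {x' i j}"
  shows "koenigs_lattice x \<and> koenigs_lattice x' \<and> koenigs_related x x'"
proof -

  \<comment> \<open>Focal points and the involution on each line\<close>
  note fund = assms(1)[unfolded fundamental_transformation_def conjugate_to_def]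
  note generic = assms(2)[unfolded generic_position_def]
  have quad: "quadrilateral_lattice x" "quadrilateral_lattice x'"
    using fund by blast+
  then have nz: "x i j \<noteq> 0" "x' i j \<noteq> 0" for i j
    unfolding quadrilateral_lattice_def by blast+
  have L: "subspace (L i j)" "dim (L i j) = 2"
    and dim_Int: "dim (L i j \<inter> L (i + 1) j) = 1" "dim (L i j \<inter> L i (j + 1)) = 1" for i j
    using fund unfolding line_congruence_def by blast+
  have xL: "x i j \<in> L i j" "x' i j \<in> L i j" for i j
    using fund by blast+
  have ne: "span {x i j} \<noteq> span {x' i j}" for i j
    using generic by blast
  note line = L xL nz ne
  have foc1: "focal1 L i j \<in> points_on (L i j)" and foc1': "focal1 L (i + 1) j \<in> points_on (L i j)" for i j
    using dim_Int(1)[of "i - 1" j] dim_Int(1)[of i j] L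
    by (auto simp: focal1_def points_on_def Int_commute subspace_inter)
  have foc2: "focal2 L i j \<in> points_on (L i j)" and foc2': "focal2 L i (j + 1) \<in> points_on (L i j)" for i j
    using dim_Int(2)[of i "j - 1"] dim_Int(2)[of i j] L
    by (auto simp: focal2_def points_on_def Int_commute subspace_inter)
  define \<iota> where "\<iota> i j = (THE \<iota>. focal_involution L i j \<iota>)" for i j
  have "focal_involution L i j (\<iota> i j)" for i j
    unfolding \<iota>_def by (rule theI'[OF assms(5)])
  then have \<iota>: "projective_involution (L i j) (\<iota> i j)"
    and \<iota>1: "\<iota> i j (focal1 L i j) = focal1 L (i + 1) j"
    and \<iota>2: "\<iota> i j (focal2 L i j) = focal2 L i (j + 1)" for i j
    unfolding focal_involution_def by blast+
  have \<iota>x: "\<iota> i j (span {x i j}) = span {x' i j}" for i j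
    unfolding \<iota>_def by (rule assms(6))
  have \<iota>\<iota>: "\<iota> i j (\<iota> i j p) = p" if "p \<in> points_on (L i j)" for i j p
    using projective_involution_involutive[OF \<iota> that] .
  \<comment> \<open>Only \<open>x\<close> is assumed to avoid the focal points. The involution swaps
    \<open>x\<close> with \<open>x'\<close> and permutes the focal points, so \<open>x'\<close>
    avoids them as well.\<close>
  have "x i j \<in> \<iota> i j p" if "p \<in> points_on (L i j)" "x' i j \<in> p" for i j p
    using \<iota>\<iota>[OF span_in_points_on[OF L(1) xL(1) nz(1)]] \<iota>x point_eq_span[OF that nz(2)]
    by (metis singletonI span_base)
  then have x'_notin: "x' i j \<notin> focal1 L i j" "x' i j \<notin> focal1 L (i + 1) j"
      "x' i j \<notin> focal2 L i j" "x' i j \<notin> focal2 L i (j + 1)" for i j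
    using foc1 foc1' foc2 foc2' \<iota>1 \<iota>2 \<iota>\<iota> generic by metis+
  have x_notin: "x i j \<notin> focal1 L i j" "x i j \<notin> focal1 L (i + 1) j"
      "x i j \<notin> focal2 L i j" "x i j \<notin> focal2 L i (j + 1)" for i j
    using generic by blast+
  \<comment> \<open>If the two focal pairs coincided, in either order, a single pair would determine
    the involution.\<close>
  have not_both: "\<not> (focal1 L i j = focal2 L i j \<and> focal1 L (i + 1) j = focal2 L i (j + 1))"
    "\<not> (focal1 L i j = focal2 L i (j + 1) \<and> focal1 L (i + 1) j = focal2 L i j)" for i j
  proof -
    note not_unique = involution_not_unique[OF L foc1 foc1', of i j]
    show "\<not> (focal1 L i j = focal2 L i j \<and> focal1 L (i + 1) j = focal2 L i (j + 1))"
      using assms(5)[of i j] not_unique unfolding focal_involution_def by auto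
    show "\<not> (focal1 L i j = focal2 L i (j + 1) \<and> focal1 L (i + 1) j = focal2 L i j)"
    proof
      assume eq: "focal1 L i j = focal2 L i (j + 1) \<and> focal1 L (i + 1) j = focal2 L i j"
      have "focal_involution L i j \<kappa> \<longleftrightarrow>
          projective_involution (L i j) \<kappa> \<and> \<kappa> (focal1 L i j) = focal1 L (i + 1) j" for \<kappa>
        using eq projective_involution_involutive[OF _ foc1, of i j \<kappa>]
        unfolding focal_involution_def by auto
      then show False
        using assms(5)[of i j] not_unique by simp
    qed
  qed

  \<comment> \<open>Focal points in homogeneous coordinates\<close>
  have "\<exists>q r s. q \<noteq> 0 \<and> r \<noteq> 0 \<and> s \<noteq> 0 \<and> x' i j + q *\<^sub>R x i j = r *\<^sub>R x' (i + 1) j + s *\<^sub>R x (i + 1) j" for i j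
    using foc1'[of i j] x_notin(1)[of "i + 1" j] x_notin(2) x'_notin(1)[of "i + 1" j] x'_notin(2)
    by (intro line_intersection_relation[OF line line]) (simp_all add: focal1_def Int_commute)
  then obtain q r s where qrs: "\<And>i j. q i j \<noteq> 0" "\<And>i j. r i j \<noteq> 0" "\<And>i j. s i j \<noteq> 0"
    and rel1: "\<And>i j. x' i j + q i j *\<^sub>R x i j = r i j *\<^sub>R x' (i + 1) j + s i j *\<^sub>R x (i + 1) j"
    by metis
  have "\<exists>q r s. q \<noteq> 0 \<and> r \<noteq> 0 \<and> s \<noteq> 0 \<and> x' i j + q *\<^sub>R x i j = r *\<^sub>R x' i (j + 1) + s *\<^sub>R x i (j + 1)" for i j
    using foc2'[of i j] x_notin(3)[of i "j + 1"] x_notin(4) x'_notin(3)[of i "j + 1"] x'_notin(4)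
    by (intro line_intersection_relation[OF line line]) (simp_all add: focal2_def Int_commute)
  then obtain Q R S where QRS: "\<And>i j. Q i j \<noteq> 0" "\<And>i j. R i j \<noteq> 0" "\<And>i j. S i j \<noteq> 0"
    and rel2: "\<And>i j. x' i j + Q i j *\<^sub>R x i j = R i j *\<^sub>R x' i (j + 1) + S i j *\<^sub>R x i (j + 1)"
    by metis

  \<comment> \<open>Gauge functions for \<open>x'\<close> and \<open>x\<close>\<close>
  have Lspan: "L i j = span {x i j, x' i j}" "L i j = span {x' i j, x i j}" for i j
    using line_spanned_by_points(3)[OF line] by (simp_all add: insert_commute)
  have not_coplanar: "\<not> (\<exists>E. subspace E \<and> dim E = 3 \<and> L i j \<union> L (i + 1) j \<union> L i (j + 1) \<subseteq> E)" for i j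
    using generic by blast
  obtain A B C A' B' C' where laplace: "laplace_eq A B C x" "laplace_eq A' B' C' x'"
    and dim: "\<And>i j. dim {x i j, x (i + 1) j, x i (j + 1)} = 3" "\<And>i j. dim {x' i j, x' (i + 1) j, x' i (j + 1)} = 3"
    using quad unfolding quadrilateral_lattice_def by blast
  have "r i (j + 1) * R i j = R (i + 1) j * r i j" for i j
    by (rule closing_condition[where x = x and x' = x' and q = q and r = r and s = s and Q = Q and R = R
        and S = S and L = L, OF laplace(1) rel1 rel2 qrs(2) QRS(2) Lspan(1) dim(1) not_coplanar])
  then obtain \<rho>' where \<rho>': "\<And>i j. \<rho>' i j \<noteq> 0" "\<And>i j. \<rho>' (i + 1) j = r i j * \<rho>' i j"
    "\<And>i j. \<rho>' i (j + 1) = R i j * \<rho>' i j"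
    using multiplicative_potential[of r R] qrs QRS by blast
  \<comment> \<open>Division by \<open>q\<close> exchanges the roles of \<open>x\<close> and
    \<open>x'\<close>, so the closing condition also yields a gauge for \<open>x\<close>.\<close>
  have rel1': "x i j + (1 / q i j) *\<^sub>R x' i j =
      (s i j / q i j) *\<^sub>R x (i + 1) j + (r i j / q i j) *\<^sub>R x' (i + 1) j" for i j
    using arg_cong[OF rel1, of "\<lambda>v. (1 / q i j) *\<^sub>R v" i j] qrs(1)[of i j]
    by (simp add: scaleR_add_right add.commute)
  have rel2': "x i j + (1 / Q i j) *\<^sub>R x' i j =
      (S i j / Q i j) *\<^sub>R x i (j + 1) + (R i j / Q i j) *\<^sub>R x' i (j + 1)" for i j
    using arg_cong[OF rel2, of "\<lambda>v. (1 / Q i j) *\<^sub>R v" i j] QRS(1)[of i j]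
    by (simp add: scaleR_add_right add.commute)
  have sq: "s i j / q i j \<noteq> 0" "S i j / Q i j \<noteq> 0" for i j
    using qrs QRS by simp_all
  have "s i (j + 1) / q i (j + 1) * (S i j / Q i j) = S (i + 1) j / Q (i + 1) j * (s i j / q i j)" for i j
    by (rule closing_condition[where x = x' and x' = x and q = "\<lambda>i j. 1 / q i j"
        and r = "\<lambda>i j. s i j / q i j" and s = "\<lambda>i j. r i j / q i j"
        and Q = "\<lambda>i j. 1 / Q i j" and R = "\<lambda>i j. S i j / Q i j"
        and S = "\<lambda>i j. R i j / Q i j" and L = L, OF laplace(2) rel1' rel2' sq Lspan(2) dim(2) not_coplanar])
  then obtain \<rho> where \<rho>: "\<And>i j. \<rho> i j \<noteq> 0" "\<And>i j. \<rho> (i + 1) j = s i j / q i j * \<rho> i j"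
    "\<And>i j. \<rho> i (j + 1) = S i j / Q i j * \<rho> i j"
    using multiplicative_potential[of "\<lambda>i j. s i j / q i j" "\<lambda>i j. S i j / Q i j"] sq by blast

  \<comment> \<open>Focal parameters in the new gauge\<close>
  define y where "y i j = \<rho> i j *\<^sub>R x i j" for i j
  define y' where "y' i j = \<rho>' i j *\<^sub>R x' i j" for i j
  \<comment> \<open>The sign is chosen so that the relations become
    \<open>\<Delta>_1 y' = a \<Delta>_1 y\<close> and
    \<open>\<Delta>_2 y' = c \<Delta>_2 y\<close>.\<close>
  define a where "a i j = - (q i j * \<rho>' i j / \<rho> i j)" for i j
  define c where "c i j = - (Q i j * \<rho>' i j / \<rho> i j)" for i j
  have ac_nz: "a i j \<noteq> 0" "c i j \<noteq> 0" for i j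
    using qrs QRS \<rho> \<rho>' by (simp_all add: a_def c_def)
  have y1: "y' i j + (- a i j) *\<^sub>R y i j = y' (i + 1) j + (- a i j) *\<^sub>R y (i + 1) j" for i j
    using arg_cong[OF rel1, of "\<lambda>v. \<rho>' i j *\<^sub>R v" i j] \<rho>(1) qrs(1)
    by (simp add: y_def y'_def a_def \<rho>(2) \<rho>'(2) scaleR_add_right mult_ac)
  have y2: "y' i j + (- c i j) *\<^sub>R y i j = y' i (j + 1) + (- c i j) *\<^sub>R y i (j + 1)" for i j
    using arg_cong[OF rel2, of "\<lambda>v. \<rho>' i j *\<^sub>R v" i j] \<rho>(1) QRS(1)
    by (simp add: y_def y'_def c_def \<rho>(3) \<rho>'(3) scaleR_add_right mult_ac)
  have span_y: "span {y i j} = span {x i j}" "span {y' i j} = span {x' i j}" for i j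
    using span_image_scale[of "{x i j}" "\<lambda>_. \<rho> i j"] span_image_scale[of "{x' i j}" "\<lambda>_. \<rho>' i j"] \<rho>(1) \<rho>'(1)
    by (simp_all add: y_def y'_def)
  have yL: "y i j \<in> L i j" "y' i j \<in> L i j" for i j
    using xL L by (simp_all add: y_def y'_def subspace_scale)
  have y_nz: "y i j \<noteq> 0" "y' i j \<noteq> 0" for i j
    using nz \<rho>(1) \<rho>'(1) by (simp_all add: y_def y'_def)
  have y_ne: "span {y i j} \<noteq> span {y' i j}" for i j
    using ne by (simp add: span_y)
  note y_line = L yL y_nz y_ne
  have comb_L: "y' i j + t *\<^sub>R y i j \<in> L i j" for i j t
    using yL L by (simp add: subspace_add subspace_scale)
  have mem1': "y' i j + (- a i j) *\<^sub>R y i j \<in> focal1 L (i + 1) j" for i j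
    using comb_L[of i j "- a i j"] comb_L[of "i + 1" j "- a i j"] y1[of i j] by (simp add: focal1_def)
  have mem2': "y' i j + (- c i j) *\<^sub>R y i j \<in> focal2 L i (j + 1)" for i j
    using comb_L[of i j "- c i j"] comb_L[of i "j + 1" "- c i j"] y2[of i j] by (simp add: focal2_def)
  \<comment> \<open>The vector \<open>y' - a y\<close> is unchanged by the first shift of
    \<open>y\<close> and \<open>y'\<close> alone, so on its own line a focal point has the parameter
    taken one step back.\<close>
  have mem1: "y' i j + (- a (i - 1) j) *\<^sub>R y i j \<in> focal1 L i j" for i j
    using mem1'[of "i - 1" j] y1[of "i - 1" j] by simp
  have mem2: "y' i j + (- c i (j - 1)) *\<^sub>R y i j \<in> focal2 L i j" for i j
    using mem2'[of i "j - 1"] y2[of i "j - 1"] by simp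
  \<comment> \<open>The constant product of homologous parameters is evaluated on both focal
    pairs.\<close>
  have eq_ac: "a (i - 1) j * a i j = c i (j - 1) * c i j" for i j
  proof -
    have "\<iota> i j (span {y i j}) = span {y' i j}"
      by (simp add: span_y \<iota>x)
    then obtain k where k: "\<And>p s t. p \<in> points_on (L i j) \<Longrightarrow> y' i j + s *\<^sub>R y i j \<in> p \<Longrightarrow>
        y' i j + t *\<^sub>R y i j \<in> \<iota> i j p \<Longrightarrow> s * t = k"
      using involution_parameter[OF y_line \<iota>] by blast
    have "(- a (i - 1) j) * (- a i j) = k" "(- c i (j - 1)) * (- c i j) = k"
      using k[OF foc1 mem1, unfolded \<iota>1, OF mem1'] k[OF foc2 mem2, unfolded \<iota>2, OF mem2'] .
    then show ?thesis by simp
  qed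
  have same_point: "p = p'" if "p \<in> points_on (L i j)" "p' \<in> points_on (L i j)"
    "y' i j + t *\<^sub>R y i j \<in> p" "y' i j + t *\<^sub>R y i j \<in> p'" for i j t p p'
  proof -
    have "y' i j + t *\<^sub>R y i j \<noteq> 0"
      using independent_pair_eq_0[OF line_spanned_by_points(2,1)[OF y_line], of t i j 1] by (auto simp: add.commute)
    then show ?thesis
      using that point_eq_span by metis
  qed
  \<comment> \<open>Equal parameters mean a common focal point; its image is then common too, so the
    pairs coincide.\<close>
  have ac_ne: "a i j \<noteq> c i j" "a (i - 1) j \<noteq> c i j" for i j
  proof -
    show "a i j \<noteq> c i j"
    proof
      assume "a i j = c i j"
      then have "focal1 L (i + 1) j = focal2 L i (j + 1)"
        using same_point[OF foc1' foc2' mem1'] mem2' by metis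
      then show False
        using \<iota>\<iota>[OF foc1[of i j]] \<iota>\<iota>[OF foc2[of i j]] \<iota>1 \<iota>2 not_both(1)[of i j] by simp
    qed
    show "a (i - 1) j \<noteq> c i j"
    proof
      assume "a (i - 1) j = c i j"
      then have "focal1 L i j = focal2 L i (j + 1)"
        using same_point[OF foc1 foc2' mem1] mem2' by metis
      then show False
        using \<iota>\<iota>[OF foc2[of i j]] \<iota>1[of i j] \<iota>2[of i j] not_both(2)[of i j] by simp
    qed
  qed

  \<comment> \<open>Integration to the potential \<open>\<theta>\<close>\<close>
  obtain \<theta> where \<theta>: "\<And>i j. \<theta> i j \<noteq> 0" "\<And>i j. \<theta> i j * \<theta> (i + 1) j = - c i (j - 1)"
    "\<And>i j. \<theta> i j * \<theta> i (j + 1) = a (i - 1) j"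
    using reciprocal_potential[of "\<lambda>i j. a (i - 1) j" "\<lambda>i j. - c i (j - 1)"] ac_nz eq_ac by auto
  have a_eq: "a i j = \<theta> (i + 1) j * \<theta> (i + 1) (j + 1)" and c_eq: "c i j = - (\<theta> i (j + 1) * \<theta> (i + 1) (j + 1))" for i j
    using \<theta>(3)[of "i + 1" j] \<theta>(2)[of i "j + 1"] by simp_all
  \<comment> \<open>Here \<open>a - c = \<theta>_(12) \<phi>\<close>.\<close>
  have \<phi>: "phi \<theta> i j \<noteq> 0" for i j
    using ac_ne(1)[of i j] by (auto simp: a_eq c_eq phi_def eq_neg_iff_add_eq_0 simp flip: distrib_right)
  \<comment> \<open>Here
    \<open>a_(-1) - c = \<theta>_(2) (\<theta>_(12) + \<theta>)\<close>.\<close>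
  have \<theta>_sum: "\<theta> (i + 1) (j + 1) + \<theta> i j \<noteq> 0" for i j
  proof
    assume "\<theta> (i + 1) (j + 1) + \<theta> i j = 0"
    then have "\<theta> i j = - \<theta> (i + 1) (j + 1)"
      by simp
    then show False
      using ac_ne(2)[of i j] \<theta>(3)[of i j] c_eq[of i j] by (simp add: mult.commute)
  qed
  have d1: "diff1 y' i j = (\<theta> (i + 1) j * \<theta> (i + 1) (j + 1)) *\<^sub>R diff1 y i j" for i j
    using y1[of i j] unfolding a_eq[symmetric] diff1_def by (simp add: algebra_simps)
  have d2: "diff2 y' i j = - ((\<theta> i (j + 1) * \<theta> (i + 1) (j + 1)) *\<^sub>R diff2 y i j)" for i j
    using y2[of i j] unfolding scaleR_minus_left[symmetric] c_eq[symmetric] diff2_def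
    by (simp add: algebra_simps)

  \<comment> \<open>The canonical gauge of \<open>x\<close>\<close>
  define F where "F i j = (\<theta> (i + 1) (j + 1) + \<theta> i j) / phi \<theta> i j" for i j
  define X where "X i j = phi \<theta> i j *\<^sub>R y i j" for i j
  have canonical: "X (i + 1) (j + 1) + X i j = F (i + 1) j *\<^sub>R X (i + 1) j + F i (j + 1) *\<^sub>R X i (j + 1)" for i j
    unfolding X_def F_def by (rule canonical_of_potential[OF \<theta>(1) \<phi> d1 d2])
  have koenigs_x: "koenigs_lattice x"
  proof (rule koenigs_lattice_of_canonical_gauge[where F = F and X = X and \<sigma> = "\<lambda>i j. phi \<theta> i j * \<rho> i j",
        OF quad(1) _ _ _ canonical])
    show "phi \<theta> i j * \<rho> i j \<noteq> 0" "F i j \<noteq> 0" for i j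
      using \<phi> \<rho> \<theta>_sum by (simp_all add: F_def)
  qed (simp add: X_def y_def)

  \<comment> \<open>The canonical gauge of \<open>x'\<close>\<close>
  define \<eta> where "\<eta> i j = 1 / \<theta> i j" for i j
  have \<phi>'_eq: "phi \<eta> i j = phi' \<theta> i j" and \<phi>': "phi' \<theta> i j \<noteq> 0" for i j
    using \<phi>[of i j] \<theta>(1) by (auto simp: \<eta>_def phi_def phi'_def field_simps)
  have \<eta>: "\<eta> i j \<noteq> 0" "phi \<eta> i j \<noteq> 0" for i j
    using \<theta>(1) \<phi>' \<phi>'_eq by (simp_all add: \<eta>_def)
  \<comment> \<open>Solving the difference relations for \<open>y\<close> inverts their
    coefficients, so \<open>1 / \<theta>\<close> is the potential for the exchanged pair.\<close>
  have e1: "diff1 y i j = (\<eta> (i + 1) j * \<eta> (i + 1) (j + 1)) *\<^sub>R diff1 y' i j" for i j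
    using \<theta>(1) by (simp add: d1 \<eta>_def)
  have e2: "diff2 y i j = - ((\<eta> i (j + 1) * \<eta> (i + 1) (j + 1)) *\<^sub>R diff2 y' i j)" for i j
    using \<theta>(1) by (simp add: d2 \<eta>_def)
  have koenigs_x': "koenigs_lattice x'"
  proof (rule koenigs_lattice_of_canonical_gauge[where F = "\<lambda>i j. (\<eta> (i + 1) (j + 1) + \<eta> i j) / phi \<eta> i j"
        and X = "\<lambda>i j. phi \<eta> i j *\<^sub>R y' i j" and \<sigma> = "\<lambda>i j. phi \<eta> i j * \<rho>' i j",
        OF quad(2) _ _ _ canonical_of_potential[OF \<eta> e1 e2]])
    show "phi \<eta> i j * \<rho>' i j \<noteq> 0" for i j
      using \<eta> \<rho>' by simp
    have "\<eta> (i + 1) (j + 1) + \<eta> i j = (\<theta> (i + 1) (j + 1) + \<theta> i j) / (\<theta> (i + 1) (j + 1) * \<theta> i j)" for i j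
      using \<theta>(1) by (simp add: \<eta>_def field_simps)
    then show "(\<eta> (i + 1) (j + 1) + \<eta> i j) / phi \<eta> i j \<noteq> 0" for i j
      using \<theta>_sum \<theta>(1) \<eta> by simp
  qed (simp add: y'_def)

  \<comment> \<open>The Koenigs transformation\<close>
  have "koenigs_transformation F \<theta> X (\<lambda>i j. phi' \<theta> i j *\<^sub>R y' i j)"
    unfolding koenigs_transformation_def
  proof (intro conjI allI)
    show "\<theta> (i + 1) (j + 1) + \<theta> i j = F i j * (\<theta> (i + 1) j + \<theta> i (j + 1))" for i j
      using \<phi>[of i j] by (simp add: F_def phi_def)
  \<comment> \<open>Division by \<open>\<phi>\<close> and \<open>\<phi>'\<close> gives back
    \<open>y\<close> and \<open>y'\<close>, so the difference equations are \<open>d1\<close> and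
    \<open>d2\<close>.\<close>
  qed (use canonical \<theta> \<phi> \<phi>' d1 d2 in \<open>simp_all add: X_def\<close>)
  then have "koenigs_related x x'"
    unfolding koenigs_related_def X_def y_def y'_def scaleR_scaleR
    using \<phi> \<phi>' \<rho>(1) \<rho>'(1)
    by (intro exI[of _ "\<lambda>i j. phi \<theta> i j * \<rho> i j"] exI[of _ "\<lambda>i j. phi' \<theta> i j * \<rho>' i j"] exI[of _ F] exI[of _ \<theta>]) simp
  with koenigs_x koenigs_x' show ?thesis
    by simp
qed

end
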